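(* Let $X$ be a Urysohn space. Then $|X|\le 2^{c(X)\cdot\overline{\Delta}(X)}$.
   Context: A topological space $X$ is Urysohn if every two distinct points of $X$ have disjoint closed neighborhoods. Write $\Delta_X=\{(x,x)\in X^2:x\in X\}$. For an infinite cardinal $\kappa$, $X$ has a regular $G_\kappa$-diagonal if there is a family $(U_\eta:\eta<\kappa)$ of open sets in $X^2$ such that $\Delta_X=\bigcap_{\eta<\kappa}U_\eta=\bigcap_{\eta<\kappa}\overline{U_\eta}$. For a Urysohn space $X$, the regular diagonal degree $\overline{\Delta}(X)$ is the minimal infinite cardinal $\kappa$ such that $X$ has a regular $G_\kappa$-diagonal. The cellularity of $X$ is $c(X)=\sup\{|\mathcal{U}|:\mathcal{U}$ is a pairwise disjoint collection of non-empty open subsets of $X\}+\omega$. *)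

theory Defs
  imports "HOL-Analysis.Product_Topology"
begin

unbundle cardinal_syntax

text \<open>
  Cardinals are represented, as in the library, by cardinal well-orders \<open>\<kappa>\<close> (\<open>Card_order \<kappa>\<close>)
  compared with \<open>\<le>o\<close> across types; the index set \<open>{\<eta>. \<eta> < \<kappa>}\<close> is \<open>Field \<kappa>\<close>.
\<close>

definition Urysohn_space :: "'a topology \<Rightarrow> bool" where
  "Urysohn_space X \<longleftrightarrow>
     (\<forall>x\<in>topspace X. \<forall>y\<in>topspace X. x \<noteq> y \<longrightarrow>
        (\<exists>A B. closedin X A \<and> x \<in> X interior_of A \<and>
               closedin X B \<and> y \<in> X interior_of B \<and> A \<inter> B = {}))"

definition diagonal :: "'a topology \<Rightarrow> ('a \<times> 'a) set" where
  "diagonal X = {(x, x) | x. x \<in> topspace X}"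

definition has_regular_G_diagonal :: "'a topology \<Rightarrow> 'k rel \<Rightarrow> bool" where
  "has_regular_G_diagonal X \<kappa> \<longleftrightarrow>
     (\<exists>U. (\<forall>\<eta>\<in>Field \<kappa>. openin (prod_topology X X) (U \<eta>)) \<and>
          diagonal X = (\<Inter>\<eta>\<in>Field \<kappa>. U \<eta>) \<and>
          diagonal X = (\<Inter>\<eta>\<in>Field \<kappa>. prod_topology X X closure_of U \<eta>))"

text \<open>
  A HOL definition has to fix the type carrying the minimal cardinal. The type \<open>'a + nat\<close> is
  large enough: for a Urysohn space the minimum exists there, and it is a minimum among the
  cardinals over every type (lemmas \<open>regular_diagonal_degree\<close> and
  \<open>regular_diagonal_degree_least\<close> below).
\<close>

definition regular_diagonal_degree :: "'a topology \<Rightarrow> ('a + nat) rel" where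
  "regular_diagonal_degree X =
     (SOME \<kappa>. Card_order \<kappa> \<and> cinfinite \<kappa> \<and> has_regular_G_diagonal X \<kappa> \<and>
        (\<forall>\<mu>::('a + nat) rel.
           Card_order \<mu> \<and> cinfinite \<mu> \<and> has_regular_G_diagonal X \<mu> \<longrightarrow> \<kappa> \<le>o \<mu>))"

text \<open>
  The supremum of a set of cardinals over a type \<open>'b\<close> is again a cardinal over \<open>'b\<close>
  (lemmas \<open>card_Sup\<close> and \<open>card_Sup_least\<close> below).
\<close>

definition card_Sup :: "'b rel set \<Rightarrow> 'b rel" where
  "card_Sup R =
     (SOME \<kappa>. Card_order \<kappa> \<and> (\<forall>r\<in>R. r \<le>o \<kappa>) \<and>
        (\<forall>\<mu>::'b rel. Card_order \<mu> \<and> (\<forall>r\<in>R. r \<le>o \<mu>) \<longrightarrow> \<kappa> \<le>o \<mu>))"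

definition cellular_family :: "'a topology \<Rightarrow> 'a set set \<Rightarrow> bool" where
  "cellular_family X \<U> \<longleftrightarrow> (\<forall>V\<in>\<U>. openin X V \<and> V \<noteq> {}) \<and> pairwise disjnt \<U>"

definition cellularity :: "'a topology \<Rightarrow> ('a set + nat) rel" where
  "cellularity X = card_Sup {|\<U>| | \<U>. cellular_family X \<U>} +c natLeq"


lemma ordLess_imp_ordIso_same_type:
  fixes \<kappa> :: "'b rel" and \<mu> :: "'c rel"
  assumes "Card_order \<mu>" "\<mu> <o \<kappa>"
  obtains \<nu> :: "'b rel" where "Card_order \<nu>" "\<nu> =o \<mu>"
proof -
  have k: "Well_order \<kappa>" "\<mu> \<le>o \<kappa>"
    using assms(2) by (auto simp: ordLess_def ordLess_imp_ordLeq)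
  have "|Field \<mu>| \<le>o |Field \<kappa>|"
    using k(2) by (rule card_of_mono2)
  then obtain f where f: "inj_on f (Field \<mu>)" "f ` Field \<mu> \<subseteq> Field \<kappa>"
    using card_of_ordLeq[of "Field \<mu>" "Field \<kappa>"] by blast
  have "|f ` Field \<mu>| =o |Field \<mu>|"
    using card_of_ordIso[of "f ` Field \<mu>" "Field \<mu>"] f(1)
    by (metis bij_betw_inv inj_on_imp_bij_betw)
  then have "|f ` Field \<mu>| =o \<mu>"
    using assms(1) card_of_Field_ordIso ordIso_transitive by blast
  then show thesis using that card_of_Card_order by blast
qed

lemma card_Sup_ex:
  fixes R :: "'b rel set"
  assumes "\<forall>r\<in>R. Card_order r"
  shows "\<exists>\<kappa>::'b rel. Card_order \<kappa> \<and> (\<forall>r\<in>R. r \<le>o \<kappa>) \<and>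
        (\<forall>\<mu>::'b rel. Card_order \<mu> \<and> (\<forall>r\<in>R. r \<le>o \<mu>) \<longrightarrow> \<kappa> \<le>o \<mu>)"
proof -
  let ?B = "{\<mu>::'b rel. Card_order \<mu> \<and> (\<forall>r\<in>R. r \<le>o \<mu>)}"
  have "r \<le>o |UNIV :: 'b set|" if "r \<in> R" for r
  proof -
    have "r =o |Field r|"
      using assms that card_of_Field_ordIso ordIso_symmetric by blast
    then show ?thesis
      using card_of_mono1[OF subset_UNIV] ordIso_ordLeq_trans by blast
  qed
  then have "|UNIV :: 'b set| \<in> ?B" by (simp add: card_of_Card_order)
  then have "?B \<noteq> {}" by blast
  moreover have "\<forall>\<mu>\<in>?B. Card_order \<mu>" by simp
  ultimately have "\<exists>\<kappa>\<in>?B. \<forall>\<mu>\<in>?B. \<kappa> \<le>o \<mu>"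
    by (rule exists_minim_Card_order)
  then show ?thesis by simp
qed

lemma card_Sup_spec:
  fixes R :: "'b rel set"
  assumes "\<forall>r\<in>R. Card_order r"
  shows "Card_order (card_Sup R) \<and> (\<forall>r\<in>R. r \<le>o card_Sup R) \<and>
        (\<forall>\<mu>::'b rel. Card_order \<mu> \<and> (\<forall>r\<in>R. r \<le>o \<mu>) \<longrightarrow> card_Sup R \<le>o \<mu>)"
  unfolding card_Sup_def by (rule someI_ex[OF card_Sup_ex[OF assms]])

lemma card_Sup:
  assumes "\<forall>r\<in>R. Card_order r"
  shows "Card_order (card_Sup R)" and "r \<in> R \<Longrightarrow> r \<le>o card_Sup R"
  using card_Sup_spec[OF assms] by simp_all

lemma card_Sup_least:
  fixes R :: "'b rel set" and \<mu> :: "'c rel"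
  assumes R: "\<forall>r\<in>R. Card_order r" and \<mu>: "Card_order \<mu>" "\<forall>r\<in>R. r \<le>o \<mu>"
  shows "card_Sup R \<le>o \<mu>"
proof (rule ccontr)
  assume n: "\<not> card_Sup R \<le>o \<mu>"
  have "Well_order (card_Sup R)" "Well_order \<mu>"
    using card_Sup(1)[OF R] \<mu>(1) by (simp_all add: card_order_on_well_order_on)
  then have less: "\<mu> <o card_Sup R"
    using n by (simp only: not_ordLeq_iff_ordLess)
  obtain \<nu> :: "'b rel" where \<nu>: "Card_order \<nu>" "\<nu> =o \<mu>"
    by (rule ordLess_imp_ordIso_same_type[OF \<mu>(1) less])
  have "\<forall>r\<in>R. r \<le>o \<nu>"
    by (intro ballI ordLeq_ordIso_trans[OF \<mu>(2)[rule_format] ordIso_symmetric[OF \<nu>(2)]])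
  then have "card_Sup R \<le>o \<nu>"
    using card_Sup_spec[OF R] \<nu>(1) by simp
  then show False by (rule notE[OF n ordLeq_ordIso_trans[OF _ \<nu>(2)]])
qed

lemma has_regular_G_diagonal_ordIso:
  assumes "has_regular_G_diagonal X \<mu>" "\<nu> =o \<mu>"
  shows "has_regular_G_diagonal X \<nu>"
proof -
  have "|Field \<nu>| =o |Field \<mu>|" using assms(2) by (rule card_of_cong)
  then obtain f where f: "bij_betw f (Field \<nu>) (Field \<mu>)"
    using card_of_ordIso by blast
  obtain U where U: "\<forall>\<eta>\<in>Field \<mu>. openin (prod_topology X X) (U \<eta>)"
    "diagonal X = (\<Inter>\<eta>\<in>Field \<mu>. U \<eta>)"
    "diagonal X = (\<Inter>\<eta>\<in>Field \<mu>. prod_topology X X closure_of U \<eta>)"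
    using assms(1) unfolding has_regular_G_diagonal_def by blast
  have F: "Field \<mu> = f ` Field \<nu>" using f by (simp add: bij_betw_def)
  show ?thesis
    unfolding has_regular_G_diagonal_def
    by (rule exI[of _ "U \<circ> f"]) (use U in \<open>simp add: F image_comp\<close>)
qed

lemma Urysohn_space_pair:
  assumes "Urysohn_space X" "x \<in> topspace X" "y \<in> topspace X" "x \<noteq> y"
  shows "\<exists>W. openin (prod_topology X X) W \<and> diagonal X \<subseteq> W \<and>
             (x, y) \<notin> prod_topology X X closure_of W"
proof -
  obtain A B where AB: "closedin X A" "x \<in> X interior_of A"
    "closedin X B" "y \<in> X interior_of B" "A \<inter> B = {}"
    using assms unfolding Urysohn_space_def by blast
  let ?P = "prod_topology X X"
  let ?W = "topspace ?P - A \<times> B"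
  have "openin ?P ?W"
    using AB by (intro openin_diff openin_topspace) (simp add: closedin_prod_Times_iff)
  moreover have "diagonal X \<subseteq> ?W"
    using AB(5) by (auto simp: diagonal_def)
  moreover have "(x, y) \<notin> ?P closure_of ?W"
  proof -
    let ?N = "(X interior_of A) \<times> (X interior_of B)"
    have "openin ?P ?N" by (simp add: openin_prod_Times_iff)
    moreover have "(x, y) \<in> ?N" using AB(2,4) by simp
    moreover have "?N \<subseteq> A \<times> B"
      using interior_of_subset[of X A] interior_of_subset[of X B] by (rule Sigma_mono)
    then have "\<not> (\<exists>z. z \<in> ?W \<and> z \<in> ?N)" by fast
    ultimately show ?thesis unfolding in_closure_of by metis
  qed
  ultimately show ?thesis by blast
qed

lemma diagonal_subset: "diagonal X \<subseteq> topspace (prod_topology X X)"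
  by (auto simp: diagonal_def)

lemma has_regular_G_diagonal_UNIV:
  fixes X :: "'a topology"
  assumes "Urysohn_space X"
  shows "has_regular_G_diagonal X |UNIV :: ('a + nat) set|"
proof -
  let ?P = "prod_topology X X"
  let ?I = "UNIV :: ('a + nat) set"
  have "|?I \<times> ?I| =o |?I|"
    by (rule card_of_Times_same_infinite) simp
  then obtain g where g: "bij_betw g ?I (?I \<times> ?I)"
    using card_of_ordIso ordIso_symmetric by blast
  define good where "good = (\<lambda>x y W. openin ?P W \<and> diagonal X \<subseteq> W \<and>
             ((x, y) \<notin> ?P closure_of W \<or> x \<notin> topspace X \<or> y \<notin> topspace X \<or> x = y))"
  have "\<exists>W. good x y W" for x y
  proof (cases "x \<in> topspace X \<and> y \<in> topspace X \<and> x \<noteq> y")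
    case True
    then show ?thesis
      using Urysohn_space_pair[OF assms] unfolding good_def by blast
  next
    case False
    then show ?thesis
      unfolding good_def using diagonal_subset[of X] openin_topspace[of ?P] by blast
  qed
  then obtain w where w: "\<And>x y. good x y (w x y)" by metis
  define U where "U = (\<lambda>\<eta>. case g \<eta> of (Inl x, Inl y) \<Rightarrow> w x y | _ \<Rightarrow> topspace ?P)"
  have T: "openin ?P (topspace ?P) \<and> diagonal X \<subseteq> topspace ?P"
    using openin_topspace diagonal_subset by (rule conjI)
  have W: "openin ?P (w x y) \<and> diagonal X \<subseteq> w x y" for x y
    using w[of x y] unfolding good_def by (elim conjE) (intro conjI)
  have o: "openin ?P (U \<eta>) \<and> diagonal X \<subseteq> U \<eta>" for \<eta>
    unfolding U_def by (cases "g \<eta>"; cases "fst (g \<eta>)"; cases "snd (g \<eta>)")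
      (simp_all only: fst_conv snd_conv prod.case sum.case T W simp_thms)
  have cl: "U \<eta> \<subseteq> ?P closure_of U \<eta>" for \<eta>
    by (rule closure_of_subset[OF openin_subset[OF conjunct1[OF o]]])
  have "p \<in> diagonal X" if p: "\<forall>\<eta>. p \<in> ?P closure_of U \<eta>" for p
  proof -
    obtain x y where xy: "p = (x, y)" by force
    have "p \<in> topspace ?P"
      by (rule subsetD[OF closure_of_subset_topspace p[rule_format]])
    then have t: "x \<in> topspace X" "y \<in> topspace X" using xy by auto
    have "(Inl x, Inl y) \<in> g ` ?I" using g by (simp add: bij_betw_def)
    then obtain \<eta> where "g \<eta> = (Inl x, Inl y)" by (metis imageE)
    then have "U \<eta> = w x y" by (simp add: U_def)
    then have "x = y" using w[of x y] p t xy unfolding good_def by metis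
    then show ?thesis using t xy by (simp add: diagonal_def)
  qed
  then have c: "(\<Inter>\<eta>. ?P closure_of U \<eta>) \<subseteq> diagonal X" by blast
  have d: "diagonal X \<subseteq> (\<Inter>\<eta>. U \<eta>)" using o by (intro INT_greatest) simp
  have uc: "(\<Inter>\<eta>. U \<eta>) \<subseteq> (\<Inter>\<eta>. ?P closure_of U \<eta>)"
    by (rule INT_anti_mono[OF subset_refl cl])
  have "diagonal X = (\<Inter>\<eta>. U \<eta>)"
    by (rule equalityI[OF d subset_trans[OF uc c]])
  moreover have "diagonal X = (\<Inter>\<eta>. ?P closure_of U \<eta>)"
    by (rule equalityI[OF subset_trans[OF d uc] c])
  ultimately show ?thesis
    unfolding has_regular_G_diagonal_def Field_card_of
    by (intro exI[of _ U] conjI ballI conjunct1[OF o])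
qed

lemma regular_diagonal_degree_ex:
  fixes X :: "'a topology"
  assumes "Urysohn_space X"
  shows "\<exists>\<kappa>::('a + nat) rel. Card_order \<kappa> \<and> cinfinite \<kappa> \<and> has_regular_G_diagonal X \<kappa> \<and>
        (\<forall>\<mu>::('a + nat) rel.
           Card_order \<mu> \<and> cinfinite \<mu> \<and> has_regular_G_diagonal X \<mu> \<longrightarrow> \<kappa> \<le>o \<mu>)"
proof -
  let ?B = "{\<mu>::('a + nat) rel. Card_order \<mu> \<and> cinfinite \<mu> \<and> has_regular_G_diagonal X \<mu>}"
  have "|UNIV :: ('a + nat) set| \<in> ?B"
    using has_regular_G_diagonal_UNIV[OF assms]
    by (simp add: card_of_card_order_on cinfinite_def Field_card_of)
  then have "?B \<noteq> {}" by blast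
  moreover have "\<forall>\<mu>\<in>?B. Card_order \<mu>" by simp
  ultimately have "\<exists>\<kappa>\<in>?B. \<forall>\<mu>\<in>?B. \<kappa> \<le>o \<mu>"
    by (rule exists_minim_Card_order)
  then show ?thesis by simp
qed

lemma regular_diagonal_degree_spec:
  fixes X :: "'a topology"
  assumes "Urysohn_space X"
  shows "Card_order (regular_diagonal_degree X) \<and> cinfinite (regular_diagonal_degree X) \<and>
    has_regular_G_diagonal X (regular_diagonal_degree X) \<and>
    (\<forall>\<mu>::('a + nat) rel. Card_order \<mu> \<and> cinfinite \<mu> \<and> has_regular_G_diagonal X \<mu> \<longrightarrow>
       regular_diagonal_degree X \<le>o \<mu>)"
  unfolding regular_diagonal_degree_def by (rule someI_ex[OF regular_diagonal_degree_ex[OF assms]])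

lemma regular_diagonal_degree:
  assumes "Urysohn_space X"
  shows "Card_order (regular_diagonal_degree X)" "cinfinite (regular_diagonal_degree X)"
    "has_regular_G_diagonal X (regular_diagonal_degree X)"
  using regular_diagonal_degree_spec[OF assms] by simp_all

lemma regular_diagonal_degree_least:
  fixes X :: "'a topology" and \<mu> :: "'k rel"
  assumes X: "Urysohn_space X"
    and \<mu>: "Card_order \<mu>" "cinfinite \<mu>" "has_regular_G_diagonal X \<mu>"
  shows "regular_diagonal_degree X \<le>o \<mu>"
proof (rule ccontr)
  assume n: "\<not> regular_diagonal_degree X \<le>o \<mu>"
  have "Well_order (regular_diagonal_degree X)" "Well_order \<mu>"
    using regular_diagonal_degree(1)[OF X] \<mu>(1) by (simp_all add: card_order_on_well_order_on)
  then have less: "\<mu> <o regular_diagonal_degree X"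
    using n by (simp only: not_ordLeq_iff_ordLess)
  obtain \<nu> :: "('a + nat) rel" where \<nu>: "Card_order \<nu>" "\<nu> =o \<mu>"
    by (rule ordLess_imp_ordIso_same_type[OF \<mu>(1) less])
  have "cinfinite \<nu>"
    by (rule cinfinite_mono[OF ordIso_imp_ordLeq[OF ordIso_symmetric[OF \<nu>(2)]] \<mu>(2)])
  moreover have "has_regular_G_diagonal X \<nu>"
    using has_regular_G_diagonal_ordIso \<mu>(3) \<nu>(2) by blast
  ultimately have "regular_diagonal_degree X \<le>o \<nu>"
    using regular_diagonal_degree_spec[OF X] \<nu>(1) by simp
  then show False by (rule notE[OF n ordLeq_ordIso_trans[OF _ \<nu>(2)]])
qed

end

theory Submission
  imports Defs
begin

text \<open>
  Let \<open>r\<close> bound the cellularity and the regular diagonal degree, witnessed by \<open>(U \<eta>)\<close>. Close off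
  under unions of at most \<open>r\<close> sets, exteriors, and a choice, for \<open>a \<times> b\<close> meeting \<open>U \<eta>\<close>, of an open
  box contained in \<open>U \<eta>\<close> and meeting \<open>a \<times> b\<close>: this gives a family \<open>A\<close> of at most \<open>2\<^sup>r\<close> open sets. By the
  bound on cellularity, the trace \<open>{a \<in> A. a \<inter> S = {}}\<close> of an open set \<open>S\<close> is determined by a single
  member of \<open>A\<close>, whose exterior is a member of \<open>A\<close> containing \<open>S\<close> and having the same trace. Hence
  disjointness of \<open>V \<times> W\<close> from \<open>U \<eta>\<close> passes to members of \<open>A\<close> enlarging \<open>V\<close> and \<open>W\<close>. If \<open>x \<in> N x \<eta>\<close>
  with \<open>N x \<eta> \<times> N x \<eta> \<subseteq> U \<eta>\<close>, then distinct points \<open>x\<close>, \<open>y\<close> cannot have \<open>N x \<eta>\<close>, \<open>N y \<eta>\<close> of equal trace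
  for all \<open>\<eta>\<close>, so \<open>x\<close> is determined by at most \<open>r\<close> members of \<open>A\<close>.
\<close>

section \<open>Cardinal arithmetic, closing off, and dense subfamilies\<close>

lemma finite_ordLeq_Cinfinite:
  assumes "finite F" "Cinfinite r"
  shows "|F| \<le>o r"
  using assms
  by (intro ordLess_imp_ordLeq Cfinite_ordLess_Cinfinite)
    (simp_all add: cfinite_def Field_card_of card_of_card_order_on)

text \<open>A nonempty subset of size at most \<open>r\<close> is the image of a function from
  \<open>Field r\<close> to \<open>S\<close>, and there are at most (2^r)^r = 2^(r * r) = 2^r such
  functions. The empty set is not such an image and is added by hand.\<close>

lemma card_of_small_subsets:
  assumes r: "Cinfinite r" and S: "|S| \<le>o ctwo ^c r"
  shows "|{B. B \<subseteq> S \<and> |B| \<le>o r}| \<le>o ctwo ^c r"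
proof -
  let ?I = "(\<lambda>f. f ` Field r) ` Func (Field r) S"
  have two: "Cinfinite (ctwo ^c r)"
    using r by (intro Cinfinite_cexp ordLeq_refl Card_order_ctwo)
  have "{B. B \<subseteq> S \<and> |B| \<le>o r} \<subseteq> {{}} \<union> ?I"
  proof
    fix B assume B: "B \<in> {B. B \<subseteq> S \<and> |B| \<le>o r}"
    show "B \<in> {{}} \<union> ?I"
    proof (cases "B = {}")
      case False
      have "r =o |Field r|"
        using r card_of_Field_ordIso ordIso_symmetric by blast
      then have "|B| \<le>o |Field r|"
        using B ordLeq_ordIso_trans by blast
      then have "\<exists>f. f ` Field r = B"
        by (simp only: card_of_ordLeq2[OF False])
      then obtain f where f: "f ` Field r = B" ..
      \<comment> \<open>\<open>Func\<close> asks for the value \<open>undefined\<close> off its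
        domain.\<close>
      let ?g = "\<lambda>x. if x \<in> Field r then f x else undefined"
      have "?g \<in> Func (Field r) S" "B = ?g ` Field r"
        using f B by (auto simp: Func_def)
      then show ?thesis by (intro UnI2 rev_image_eqI)
    qed simp
  qed
  then have "|{B. B \<subseteq> S \<and> |B| \<le>o r}| \<le>o |{{}} \<union> ?I|"
    by (rule card_of_mono1)
  also have "|{{}} \<union> ?I| \<le>o ctwo ^c r"
  proof (rule Un_Cinfinite_bound[OF _ _ two])
    show "|{{}}| \<le>o ctwo ^c r"
      using two by (intro Card_order_singl_ordLeq) (auto simp: cinfinite_def)
    have "|?I| \<le>o |Func (Field r) S|"
      by (rule card_of_image)
    also have "|Func (Field r) S| =o |S| ^c r"
      unfolding cexp_def Field_card_of by (rule card_of_refl)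
    also have "|S| ^c r \<le>o (ctwo ^c r) ^c r"
      using S r by (intro cexp_mono1) auto
    also have "(ctwo ^c r) ^c r =o ctwo ^c (r *c r)"
      using r by (intro cexp_cprod Card_order_ctwo)
    also have "ctwo ^c (r *c r) =o ctwo ^c r"
      using r by (intro cexp_cong2 cprod_infinite Card_order_ctwo) (auto simp: Card_order_cprod)
    finally show "|?I| \<le>o ctwo ^c r" .
  qed
  finally show ?thesis .
qed

text \<open>Iterate \<open>G\<close> along the successor cardinal of \<open>r\<close>. By its
  regularity, a subset of size at most \<open>r\<close> of the union of the increasing stages lies
  in one stage, and its value under \<open>G\<close> lies in a later one.\<close>

lemma ex_closed_family:
  fixes G :: "'b set \<Rightarrow> 'b set"
  assumes r: "Cinfinite r" and G: "\<And>B. |B| \<le>o r \<Longrightarrow> |G B| \<le>o ctwo ^c r"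
  obtains A where "|A| \<le>o ctwo ^c r" "\<And>B. B \<subseteq> A \<Longrightarrow> |B| \<le>o r \<Longrightarrow> G B \<subseteq> A"
proof -
  define s where "s = cardSuc r"
  have s: "Cinfinite s"
    using r unfolding s_def by (rule Cinfinite_cardSuc)
  then have wo: "Well_order s"
    by (simp add: card_order_on_well_order_on)
  then have wf: "wf (s - Id)" and tr: "trans s" and an: "antisym s"
    by (auto simp: well_order_on_def linear_order_on_def partial_order_on_def preorder_on_def)
  have two: "Cinfinite (ctwo ^c r)"
    using r by (intro Cinfinite_cexp ordLeq_refl Card_order_ctwo)
  \<comment> \<open>Cantor's theorem: \<open>r\<close> is below 2^r, so its successor is at most 2^r
    and the iteration is short enough.\<close>
  have s_le: "s \<le>o ctwo ^c r"
    unfolding s_def using r ordLess_ctwo_cexp[of r]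
    by (simp add: cardSuc_ordLess_ordLeq[symmetric] Card_order_cexp)
  have Fs: "|Field s| \<le>o ctwo ^c r"
    using s s_le card_of_Field_ordIso ordIso_ordLeq_trans by blast
  define small where "small = (\<lambda>C :: 'b set. {B. B \<subseteq> C \<and> |B| \<le>o r})"
  define H where "H = wfrec (s - Id) (\<lambda>h i. \<Union> (G ` small (\<Union> (h ` underS s i))))"
  define C where "C = (\<lambda>i. \<Union> (H ` underS s i))"
  have H: "H i = \<Union> (G ` small (C i))" for i
  proof -
    have "cut H (s - Id) i ` underS s i = H ` underS s i"
      by (intro image_cong) (auto simp: cut_def underS_def)
    moreover have "H i = \<Union> (G ` small (\<Union> (cut H (s - Id) i ` underS s i)))"
      unfolding H_def by (subst wfrec[OF wf]) (rule refl)
    ultimately show ?thesis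
      unfolding C_def by simp
  qed
  have C_le: "|C i| \<le>o ctwo ^c r" if "\<And>j. (j, i) \<in> s - Id \<Longrightarrow> |H j| \<le>o ctwo ^c r" for i
  proof -
    have "underS s i \<subseteq> Field s"
      by (auto simp: underS_def Field_def)
    then have "|underS s i| \<le>o ctwo ^c r"
      using card_of_mono1 Fs ordLeq_transitive by blast
    then show ?thesis
      unfolding C_def using that two
      by (intro UNION_Cinfinite_bound) (auto simp: underS_def)
  qed
  have H_le: "|H i| \<le>o ctwo ^c r" for i
    using wf
  proof (induction i rule: wf_induct_rule)
    case (less i)
    then have "|small (C i)| \<le>o ctwo ^c r"
      unfolding small_def using C_le r by (intro card_of_small_subsets) auto
    then show ?case
      unfolding H using G two by (intro UNION_Cinfinite_bound) (auto simp: small_def)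
  qed
  let ?A = "\<Union>i\<in>Field s. C i"
  have "|?A| \<le>o ctwo ^c r"
    using Fs C_le H_le two by (intro UNION_Cinfinite_bound) auto
  moreover have "G B \<subseteq> ?A" if B: "B \<subseteq> ?A" "|B| \<le>o r" for B
  proof -
    have "underS s i \<subseteq> underS s j" if "(i, j) \<in> s" for i j
      using that tr an by (fastforce simp: underS_def trans_def antisym_def)
    then have "relChain s C"
      unfolding relChain_def C_def by blast
    then obtain i where i: "i \<in> Field s" "B \<subseteq> C i"
      using cardSuc_UNION_Cinfinite[of r C B] r B unfolding s_def by blast
    then have "G B \<subseteq> H i"
      using B unfolding H small_def by blast
    \<comment> \<open>\<open>G B\<close> lies in \<open>H i\<close> but \<open>C i\<close> collects
      only the stages strictly before \<open>i\<close>; an infinite cardinal has no last element, so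
      some later \<open>j\<close> works.\<close>
    moreover obtain j where "j \<in> Field s" "i \<noteq> j" "(i, j) \<in> s"
      using infinite_Card_order_limit[of s i] s i by (auto simp: cinfinite_def)
    ultimately show ?thesis
      unfolding C_def underS_def by blast
  qed
  ultimately show thesis
    using that by blast
qed

text \<open>Take by Zorn a maximal cellular family whose members each lie in a member of \<V>, and
  choose one such member of \<V> for each.\<close>

lemma dense_subfamily:
  assumes cell: "\<And>\<C>. cellular_family X \<C> \<Longrightarrow> |\<C>| \<le>o r"
    and V: "\<And>S. S \<in> \<V> \<Longrightarrow> openin X S"
  obtains \<W> where "\<W> \<subseteq> \<V>" "|\<W>| \<le>o r" "\<Union>\<V> \<subseteq> X closure_of \<Union>\<W>"
proof -
  let ?R = "{\<C>. cellular_family X \<C> \<and> (\<forall>C\<in>\<C>. \<exists>S\<in>\<V>. C \<subseteq> S)}"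
  have "\<exists>M\<in>?R. \<forall>\<C>\<in>?R. M \<subseteq> \<C> \<longrightarrow> \<C> = M"
  proof (rule subset_Zorn')
    fix K assume K: "subset.chain ?R K"
    then have "pairwise disjnt (\<Union>K)"
      by (intro pairwise_chain_Union)
        (auto simp: subset.chain_def cellular_family_def chain_subset_def)
    then show "\<Union>K \<in> ?R"
      using K by (fastforce simp: subset.chain_def cellular_family_def)
  qed
  then obtain M where MR: "M \<in> ?R" and max: "\<forall>\<C>\<in>?R. M \<subseteq> \<C> \<longrightarrow> \<C> = M"
    by (elim bexE)
  then have M: "cellular_family X M" "\<forall>C\<in>M. \<exists>S\<in>\<V>. C \<subseteq> S"
    by simp_all
  obtain f where f: "\<And>C. C \<in> M \<Longrightarrow> f C \<in> \<V> \<and> C \<subseteq> f C"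
    using M(2) by metis
  have "|f ` M| \<le>o r"
    using card_of_image cell[OF M(1)] ordLeq_transitive by blast
  moreover have "\<Union>\<V> \<subseteq> X closure_of \<Union>(f ` M)"
  proof
    fix x assume "x \<in> \<Union>\<V>"
    then obtain S where S: "S \<in> \<V>" "x \<in> S" by blast
    have "\<exists>y. y \<in> \<Union>(f ` M) \<and> y \<in> T" if T: "x \<in> T" "openin X T" for T
    proof (rule ccontr)
      assume "\<not> (\<exists>y. y \<in> \<Union>(f ` M) \<and> y \<in> T)"
      then have d: "C \<inter> (S \<inter> T) = {}" if "C \<in> M" for C
        using f that by blast
      \<comment> \<open>By maximality \<open>S \<inter> T\<close> already belongs to
        \<open>M\<close>; then it is disjoint from itself, although it contains
        \<open>x\<close>.\<close>
      then have "insert (S \<inter> T) M \<in> ?R"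
        using M S T V[OF S(1)]
        by (auto simp: cellular_family_def pairwise_insert disjnt_def)
      then have "S \<inter> T \<in> M"
        using max[rule_format, of "insert (S \<inter> T) M"] by blast
      then show False
        using d S T by blast
    qed
    then show "x \<in> X closure_of \<Union>(f ` M)"
      using openin_subset[OF V[OF S(1)]] S(2) by (auto simp: in_closure_of)
  qed
  ultimately show thesis
    using that[of "f ` M"] f by blast
qed

section \<open>The bound on the number of points\<close>

lemma card_topspace_regular_G_diagonal:
  fixes X :: "'a topology"
  assumes r: "Cinfinite r"
    and cell: "\<And>\<C>. cellular_family X \<C> \<Longrightarrow> |\<C>| \<le>o r"
    and diag: "has_regular_G_diagonal X k" and k: "|Field k| \<le>o r"
  shows "|topspace X| \<le>o ctwo ^c r"
proof -
  let ?P = "prod_topology X X"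
  obtain U where U: "\<forall>\<eta>\<in>Field k. openin ?P (U \<eta>)"
    and U1: "diagonal X = (\<Inter>\<eta>\<in>Field k. U \<eta>)"
    and U2: "diagonal X = (\<Inter>\<eta>\<in>Field k. ?P closure_of U \<eta>)"
    using diag unfolding has_regular_G_diagonal_def by (elim exE conjE)
  have two: "Cinfinite (ctwo ^c r)"
    using r by (intro Cinfinite_cexp ordLeq_refl Card_order_ctwo)
  have r_le: "r \<le>o ctwo ^c r"
    using r ordLess_ctwo_cexp ordLess_imp_ordLeq by blast
  have kr: "|Field k| \<le>o ctwo ^c r"
    using k r_le ordLeq_transitive by blast

  \<comment> \<open>The implication makes the choice total, so \<open>g\<close> and \<open>h\<close>
    have open values for all arguments.\<close>
  have "\<exists>S T. openin X S \<and> openin X T \<and>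
      (\<eta> \<in> Field k \<and> a \<times> b \<inter> U \<eta> \<noteq> {} \<longrightarrow> S \<times> T \<subseteq> U \<eta> \<and> S \<inter> a \<noteq> {} \<and> T \<inter> b \<noteq> {})" for \<eta> a b
  proof (cases "\<eta> \<in> Field k \<and> a \<times> b \<inter> U \<eta> \<noteq> {}")
    case True
    then obtain s t where st: "s \<in> a" "t \<in> b" "(s, t) \<in> U \<eta>" by blast
    then obtain S T where "openin X S" "openin X T" "s \<in> S" "t \<in> T" "S \<times> T \<subseteq> U \<eta>"
      using U True unfolding openin_prod_topology_alt by meson
    then show ?thesis using st by blast
  qed blast
  then obtain g h where g: "\<And>\<eta> a b. openin X (g \<eta> a b)" and h: "\<And>\<eta> a b. openin X (h \<eta> a b)"
    and gh: "\<And>\<eta> a b. \<eta> \<in> Field k \<Longrightarrow> a \<times> b \<inter> U \<eta> \<noteq> {} \<Longrightarrow>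
      g \<eta> a b \<times> h \<eta> a b \<subseteq> U \<eta> \<and> g \<eta> a b \<inter> a \<noteq> {} \<and> h \<eta> a b \<inter> b \<noteq> {}"
    by metis

  define ext where "ext = (\<lambda>S. topspace X - X closure_of S)"
  define G where "G = (\<lambda>B. {\<Union>B, ext (\<Union>B)} \<union>
    (\<Union>a\<in>B. \<Union>b\<in>B. \<Union>\<eta>\<in>Field k. {g \<eta> a b, h \<eta> a b}))"
  have "|G B| \<le>o ctwo ^c r" if "|B| \<le>o r" for B
  proof -
    have "|B| \<le>o ctwo ^c r"
      using that r_le ordLeq_transitive by blast
    then show ?thesis
      unfolding G_def using two kr
      by (intro Un_Cinfinite_bound UNION_Cinfinite_bound ballI
          finite_ordLeq_Cinfinite[of "{_, _}"]) auto
  qed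
  then obtain A0 where A0: "|A0| \<le>o ctwo ^c r"
    "\<And>B. B \<subseteq> A0 \<Longrightarrow> |B| \<le>o r \<Longrightarrow> G B \<subseteq> A0"
    using ex_closed_family[OF r, of G] by metis
  \<comment> \<open>The closing-off may produce sets that are not open. Discarding them keeps the
    closure property, as \<open>G\<close> sends families of open sets to families of open
    sets.\<close>
  define A where "A = {a \<in> A0. openin X a}"
  have A_le: "|A| \<le>o ctwo ^c r"
    using card_of_mono1[of A A0] A0(1) ordLeq_transitive unfolding A_def by blast
  have A_open: "openin X a" if "a \<in> A" for a
    using that by (simp add: A_def)
  have A_G: "G B \<subseteq> A" if "B \<subseteq> A" "|B| \<le>o r" for B
  proof -
    have "openin X (\<Union>B)"
      using that A_open by blast
    moreover have "openin X (ext (\<Union>B))"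
      by (simp add: ext_def openin_diff)
    ultimately have "openin X a" if "a \<in> G B" for a
      using that g h unfolding G_def by blast
    moreover have "G B \<subseteq> A0"
      using that A0(2) unfolding A_def by blast
    ultimately show ?thesis
      unfolding A_def by blast
  qed
  have A_Union: "\<Union>B \<in> A" if "B \<subseteq> A" "|B| \<le>o r" for B
    using A_G[OF that] unfolding G_def by blast
  have A_ext: "ext a \<in> A" if "a \<in> A" for a
  proof -
    have "G {a} \<subseteq> A"
      using that by (intro A_G finite_ordLeq_Cinfinite r) auto
    then show ?thesis
      by (simp add: G_def)
  qed
  have A_gh: "g \<eta> a b \<in> A" "h \<eta> a b \<in> A" if "a \<in> A" "b \<in> A" "\<eta> \<in> Field k" for \<eta> a b
  proof -
    have "G {a, b} \<subseteq> A"
      using that by (intro A_G finite_ordLeq_Cinfinite r) auto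
    moreover have "{g \<eta> a b, h \<eta> a b} \<subseteq> G {a, b}"
      using that(3) unfolding G_def by blast
    ultimately show "g \<eta> a b \<in> A" "h \<eta> a b \<in> A"
      by auto
  qed

  have "\<exists>b\<in>A. b \<inter> S = {} \<and> (\<forall>a\<in>A. a \<inter> S = {} \<longrightarrow> a \<subseteq> X closure_of b)" if "openin X S" for S
  proof -
    obtain \<W> where W: "\<W> \<subseteq> {a \<in> A. a \<inter> S = {}}" "|\<W>| \<le>o r"
      "\<Union>{a \<in> A. a \<inter> S = {}} \<subseteq> X closure_of \<Union>\<W>"
      by (rule dense_subfamily[where X = X and r = r and \<V> = "{a \<in> A. a \<inter> S = {}}"])
        (use cell A_open in auto)
    have "\<Union>\<W> \<in> A"
      using W by (intro A_Union) auto
    then show ?thesis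
      using W by (intro bexI[of _ "\<Union>\<W>"]) blast+
  qed
  then obtain code where code: "\<And>S. openin X S \<Longrightarrow> code S \<in> A \<and> code S \<inter> S = {}"
    and code_max: "\<And>S a. openin X S \<Longrightarrow> a \<in> A \<Longrightarrow> a \<inter> S = {} \<Longrightarrow> a \<subseteq> X closure_of code S"
    by metis
  \<comment> \<open>So \<open>code S\<close> determines which members of \<open>A\<close> meet
    \<open>S\<close>: an open set disjoint from \<open>code S\<close> also misses its
    closure.\<close>
  have code_iff: "a \<inter> S = {} \<longleftrightarrow> a \<subseteq> X closure_of code S" if "openin X S" "a \<in> A" for S a
  proof
    assume "a \<subseteq> X closure_of code S"
    moreover have "S \<inter> X closure_of code S = {}"
      using code[OF that(1)] openin_Int_closure_of_eq_empty[OF that(1)] by blast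
    ultimately show "a \<inter> S = {}" by blast
  qed (use code_max that in blast)
  have hull: "\<exists>a\<in>A. S \<subseteq> a \<and> (\<forall>c\<in>A. c \<inter> S = {} \<longrightarrow> c \<inter> a = {})" if S: "openin X S" for S
  proof (intro bexI[of _ "ext (code S)"] conjI ballI impI)
    show "ext (code S) \<in> A"
      using A_ext code[OF S] by blast
    show "S \<subseteq> ext (code S)"
      using code[OF S] openin_Int_closure_of_eq_empty[OF S, of "code S"] openin_subset[OF S]
      unfolding ext_def by blast
    show "c \<inter> ext (code S) = {}" if "c \<in> A" "c \<inter> S = {}" for c
      using code_max[OF S that] unfolding ext_def by blast
  qed

  have "\<exists>S. openin X S \<and> x \<in> S \<and> S \<times> S \<subseteq> U \<eta>" if x: "x \<in> topspace X" and \<eta>: "\<eta> \<in> Field k" for x \<eta>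
  proof -
    have "(x, x) \<in> U \<eta>"
      using U1 x \<eta> unfolding diagonal_def by blast
    then obtain S T where "openin X S" "openin X T" "x \<in> S" "x \<in> T" "S \<times> T \<subseteq> U \<eta>"
      using U \<eta> unfolding openin_prod_topology_alt by meson
    then show ?thesis
      by (intro exI[of _ "S \<inter> T"]) auto
  qed
  then obtain N where N: "\<And>x \<eta>. x \<in> topspace X \<Longrightarrow> \<eta> \<in> Field k \<Longrightarrow>
      openin X (N x \<eta>) \<and> x \<in> N x \<eta> \<and> N x \<eta> \<times> N x \<eta> \<subseteq> U \<eta>"
    by metis
  \<comment> \<open>Tagging each code with its index lets a set of size at most \<open>r\<close>
    record the whole map from indices to codes.\<close>
  define \<Phi> where "\<Phi> = (\<lambda>x. (\<lambda>\<eta>. (\<eta>, code (N x \<eta>))) ` Field k)"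

  have "inj_on \<Phi> (topspace X)"
  proof (rule inj_onI, rule ccontr)
    fix x y assume x: "x \<in> topspace X" and y: "y \<in> topspace X" and eq: "\<Phi> x = \<Phi> y" and "x \<noteq> y"
    then have "(x, y) \<notin> diagonal X"
      by (simp add: diagonal_def)
    then obtain \<eta> where \<eta>: "\<eta> \<in> Field k" "(x, y) \<notin> ?P closure_of U \<eta>"
      unfolding U2 by blast
    moreover have "(x, y) \<in> topspace ?P"
      using x y by simp
    ultimately obtain Q where "(x, y) \<in> Q" "openin ?P Q" and Q: "\<forall>z\<in>U \<eta>. z \<notin> Q"
      unfolding in_closure_of by blast
    then obtain V W where V: "openin X V" "x \<in> V" and W: "openin X W" "y \<in> W"
      and "V \<times> W \<subseteq> Q"
      unfolding openin_prod_topology_alt by meson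
    then have VW: "V \<times> W \<inter> U \<eta> = {}"
      using Q by blast
    obtain v where v: "v \<in> A" "V \<subseteq> v" "\<And>c. c \<in> A \<Longrightarrow> c \<inter> V = {} \<Longrightarrow> c \<inter> v = {}"
      using hull[OF V(1)] by metis
    obtain w where w: "w \<in> A" "W \<subseteq> w" "\<And>c. c \<in> A \<Longrightarrow> c \<inter> W = {} \<Longrightarrow> c \<inter> w = {}"
      using hull[OF W(1)] by metis
    have vw: "v \<times> w \<inter> U \<eta> = {}"
    proof (rule ccontr)
      \<comment> \<open>The chosen box inside \<open>U \<eta>\<close> has sides in \<open>A\<close>
        meeting \<open>v\<close> and \<open>w\<close>, hence meeting \<open>V\<close> and
        \<open>W\<close>; so \<open>U \<eta>\<close> would meet \<open>V \<times> W\<close>.\<close>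
      assume "v \<times> w \<inter> U \<eta> \<noteq> {}"
      note gh = gh[OF \<eta>(1) this]
      have "g \<eta> v w \<inter> V \<noteq> {}" "h \<eta> v w \<inter> W \<noteq> {}"
        using gh v(3) w(3) A_gh[OF v(1) w(1) \<eta>(1)] by blast+
      then show False
        using VW gh by blast
    qed
    \<comment> \<open>Equal codes carry the meeting of \<open>v\<close> with
      \<open>N x \<eta>\<close> over to \<open>N y \<eta>\<close>. Since \<open>w\<close> meets
      \<open>N y \<eta>\<close> at \<open>y\<close>, the square of \<open>N y \<eta>\<close> inside
      \<open>U \<eta>\<close> meets \<open>v \<times> w\<close>.\<close>
    have "code (N x \<eta>) = code (N y \<eta>)"
      using eq \<eta>(1) unfolding \<Phi>_def by blast
    moreover have "v \<inter> N x \<eta> \<noteq> {}"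
      using N[OF x \<eta>(1)] V v by blast
    ultimately have "v \<inter> N y \<eta> \<noteq> {}"
      using code_iff[OF _ v(1)] N[OF x \<eta>(1)] N[OF y \<eta>(1)] by metis
    moreover have "w \<inter> N y \<eta> \<noteq> {}"
      using N[OF y \<eta>(1)] W w by blast
    ultimately show False
      using vw N[OF y \<eta>(1)] by blast
  qed
  moreover have "\<Phi> ` topspace X \<subseteq> {B. B \<subseteq> Field k \<times> A \<and> |B| \<le>o r}"
  proof -
    have "|\<Phi> x| \<le>o r" for x
      unfolding \<Phi>_def using card_of_image k ordLeq_transitive by blast
    then show ?thesis
      using code N unfolding \<Phi>_def by auto
  qed
  ultimately have *: "|topspace X| \<le>o |{B. B \<subseteq> Field k \<times> A \<and> |B| \<le>o r}|"
    using card_of_ordLeq by blast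
  have "|Field k \<times> A| \<le>o ctwo ^c r"
    using kr A_le two by (intro card_of_Times_ordLeq_infinite_Field) (auto simp: cinfinite_def)
  then have "|{B. B \<subseteq> Field k \<times> A \<and> |B| \<le>o r}| \<le>o ctwo ^c r"
    by (rule card_of_small_subsets[OF r])
  with * show ?thesis
    by (rule ordLeq_transitive)
qed

section \<open>Passage to the two cardinal invariants\<close>

lemma cellularity_upper:
  assumes "cellular_family X \<C>"
  shows "|\<C>| \<le>o cellularity X"
proof -
  let ?R = "{|\<U>| | \<U>. cellular_family X \<U>}"
  have R: "\<forall>s\<in>?R. Card_order s"
    using card_of_Card_order by blast
  have "|\<C>| \<le>o card_Sup ?R"
    using card_Sup(2)[OF R] assms by blast
  also have "card_Sup ?R \<le>o cellularity X"
    unfolding cellularity_def by (intro ordLeq_csum1 card_Sup(1) R)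
  finally show ?thesis .
qed

lemma Cinfinite_cellularity: "Cinfinite (cellularity X)"
  unfolding cellularity_def using natLeq_Cinfinite by (intro Cinfinite_csum) blast

theorem theorem4p2:
  fixes X :: "'a topology"
  assumes "Urysohn_space X"
  shows "|topspace X| \<le>o ctwo ^c (cellularity X *c regular_diagonal_degree X)"
proof -
  let ?c = "cellularity X" and ?d = "regular_diagonal_degree X"
  \<comment> \<open>The Urysohn property enters here: it ensures that the minimal degree is
    attained.\<close>
  note d = regular_diagonal_degree[OF assms]
  have cd: "?c \<le>o ?c *c ?d" "?d \<le>o ?c *c ?d"
    using Cinfinite_cellularity[of X] d
    by (auto intro!: ordLeq_cprod2 Cinfinite_Cnotzero ordLeq_ordIso_trans[OF ordLeq_cprod2 cprod_com])
  show ?thesis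
  proof (rule card_topspace_regular_G_diagonal[OF _ _ d(3)])
    show "Cinfinite (?c *c ?d)"
      using Cinfinite_cellularity[of X] d Cinfinite_cprod2 Cinfinite_Cnotzero by blast
    show "|\<C>| \<le>o ?c *c ?d" if "cellular_family X \<C>" for \<C>
      using cellularity_upper[OF that] cd(1) by (rule ordLeq_transitive)
    show "|Field ?d| \<le>o ?c *c ?d"
      using card_of_Field_ordIso[OF d(1)] cd(2) by (rule ordIso_ordLeq_trans)
  qed
qed

end
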